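(* Let $G=(V,E)$ be a finite graph with no multi- or self-edges, with spin-spin couplings $\{J_{x,y}\}_{\{x,y\}\in E}$ and local magnetic fields $\{h_x\}_{x\in V}$ (real numbers), let $\beta\ge0$ and let $\varepsilon>0$. Let $\bar K=\max\{|\tilde h_x(\boldsymbol\sigma)|:x\in V,\ \boldsymbol\sigma\in\{\pm1\}^V\}$ and $v=\sum_{\{x,y\}\in E}J_{x,y}^2+\sum_{x\in V}h_x^2$. If $$\beta\le\frac1{2\bar K}\log\frac{\varepsilon\sqrt v}{2\bar K},$$ then there is a pinning parameter $q\ge0$ for which the following both hold at the same time: (1) The stochastic cellular automata (SCA) is faster than the Glauber dynamics in terms of the expected number of spin-flips per update, i.e., $$E^{\mathrm G}_\beta[|D_{\boldsymbol\sigma,X_{\boldsymbol\sigma}}|]\le E^{\mathrm{SCA}}_{\beta,q}[|D_{\boldsymbol\sigma,X_{\boldsymbol\sigma}}|]\qquad\text{for any }\boldsymbol\sigma\in\{\pm1\}^V.$$ (2) The SCA equilibrium $\pi^{\mathrm{SCA}}_{\beta,q}$ is $\varepsilon$-close to the target Gibbs distribution $\pi^{\mathrm G}_\beta$ in the sense of order-preservation. In particular, if $\pi^{\mathrm{SCA}}_{\beta,q}$ takes on its highest point at $\boldsymbol\sigma$, then $H(\boldsymbol\sigma)\le H(\boldsymbol\tau)+\varepsilon R_H$ holds for all $\boldsymbol\tau\in\{\pm1\}^V$.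
   Context: Setting: $J_{x,y}=J_{y,x}$ is indexed by unordered pairs, and $J_{x,y}=0$ if $\{x,y\}\notin E$. For $\boldsymbol\sigma=\{\sigma_x\}_{x\in V}\in\{\pm1\}^V$ the Hamiltonian is $$H(\boldsymbol\sigma)=-\sum_{\{x,y\}\in E}J_{x,y}\sigma_x\sigma_y-\sum_{x\in V}h_x\sigma_x.$$ The cavity fields are $\tilde h_x(\boldsymbol\sigma)=\sum_{y\in V}J_{x,y}\sigma_y+h_x$. The range of $H$ is $R_H=\max_{\boldsymbol\sigma,\boldsymbol\tau\in\{\pm1\}^V}|H(\boldsymbol\sigma)-H(\boldsymbol\tau)|$. Gibbs and Glauber: at inverse temperature $\beta\ge0$, $w^{\mathrm G}_\beta(\boldsymbol\sigma)=e^{-\beta H(\boldsymbol\sigma)}$ and $\pi^{\mathrm G}_\beta(\boldsymbol\sigma)=w^{\mathrm G}_\beta(\boldsymbol\sigma)/\sum_{\boldsymbol\sigma'}w^{\mathrm G}_\beta(\boldsymbol\sigma')$. Let $\boldsymbol\sigma^x$ be $\boldsymbol\sigma$ with the spin at $x$ flipped. The Glauber transition probability is $$P^{\mathrm G}_\beta(\boldsymbol\sigma,\boldsymbol\sigma^x)=\frac1{|V|}\frac{w^{\mathrm G}_\beta(\boldsymbol\sigma^x)}{w^{\mathrm G}_\beta(\boldsymbol\sigma)+w^{\mathrm G}_\beta(\boldsymbol\sigma^x)},\qquad P^{\mathrm G}_\beta(\boldsymbol\sigma,\boldsymbol\sigma)=1-\sum_{x\in V}P^{\mathrm G}_\beta(\boldsymbol\sigma,\boldsymbol\sigma^x),$$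 and $P^{\mathrm G}_\beta(\boldsymbol\sigma,\boldsymbol\tau)=0$ otherwise. SCA: let $\tilde H(\boldsymbol\sigma,\boldsymbol\tau)=-\frac12\sum_{x,y\in V}J_{x,y}\sigma_x\tau_y-\frac12\sum_{x\in V}h_x(\sigma_x+\tau_x)$. For pinning parameter $q\ge0$, $$w^{\mathrm{SCA}}_{\beta,q}(\boldsymbol\sigma)=\sum_{\boldsymbol\tau\in\{\pm1\}^V}\exp\Big(-\beta\tilde H(\boldsymbol\sigma,\boldsymbol\tau)+q\sum_{x\in V}\sigma_x\tau_x\Big),\qquad \pi^{\mathrm{SCA}}_{\beta,q}(\boldsymbol\sigma)=\frac{w^{\mathrm{SCA}}_{\beta,q}(\boldsymbol\sigma)}{\sum_{\boldsymbol\sigma'}w^{\mathrm{SCA}}_{\beta,q}(\boldsymbol\sigma')},$$ $$P^{\mathrm{SCA}}_{\beta,q}(\boldsymbol\sigma,\boldsymbol\tau)=\frac1{w^{\mathrm{SCA}}_{\beta,q}(\boldsymbol\sigma)}\exp\Big(-\beta\tilde H(\boldsymbol\sigma,\boldsymbol\tau)+q\sum_{x\in V}\sigma_x\tau_x\Big).$$ Spin-flips: $D_{\boldsymbol\sigma,\boldsymbol\tau}=\{x\in V:\sigma_x\ne\tau_x\}$. For $P^*=P^{\mathrm G}_\beta$ (resp. $P^{\mathrm{SCA}}_{\beta,q}$), with $X_{\boldsymbol\sigma}$ a $\{\pm1\}^V$-valued random variable of law $P^*(\boldsymbol\sigma,\cdot)$, the expected number of spin-flips per update from $\boldsymbol\sigma$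 is $E^*[|D_{\boldsymbol\sigma,X_{\boldsymbol\sigma}}|]=\sum_{\boldsymbol\tau}|D_{\boldsymbol\sigma,\boldsymbol\tau}|P^*(\boldsymbol\sigma,\boldsymbol\tau)$, where $E^*=E^{\mathrm G}_\beta$ (resp. $E^{\mathrm{SCA}}_{\beta,q}$). Closeness: a probability measure $\mu$ on $\{\pm1\}^V$ is $\varepsilon$-close to the target Gibbs $\pi^{\mathrm G}_\beta$ in the sense of order-preservation if, for all $\boldsymbol\sigma,\boldsymbol\tau\in\{\pm1\}^V$, $\mu(\boldsymbol\sigma)\ge\mu(\boldsymbol\tau)$ implies $H(\boldsymbol\sigma)\le H(\boldsymbol\tau)+\varepsilon R_H$.
   Formalization: Two conditions are added, since the claim fails without them: if β=0 then ε≥1 (at β=0 the SCA equilibrium is uniform, so (2) fails for ε<1 when K̄>0), and if |V|=1 then β=0 (for one vertex with h≠0 and β>0, no q≥0 satisfies (1)). *)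

theory Defs
  imports Complex_Main "HOL-Library.FuncSet"
begin

definition simple_graph :: "'a set \<Rightarrow> 'a set set \<Rightarrow> bool" where
  "simple_graph V E \<longleftrightarrow> finite V \<and> (\<forall>e\<in>E. e \<subseteq> V \<and> card e = 2)"

(* Configurations are extensional functions, so that they form a finite set and are
   determined by their values on V. *)
definition configs :: "'a set \<Rightarrow> ('a \<Rightarrow> real) set" where
  "configs V = V \<rightarrow>\<^sub>E {1, -1}"

(* The couplings J are a function on edges; this is J_{x,y}, symmetric by construction and
   zero off the edge set. *)
definition coupling :: "'a set set \<Rightarrow> ('a set \<Rightarrow> real) \<Rightarrow> 'a \<Rightarrow> 'a \<Rightarrow> real" where
  "coupling E J x y = (if {x, y} \<in> E then J {x, y} else 0)"

(* For an edge e = {x, y} the product over e is the product of the two end spins. *)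
definition hamiltonian ::
  "'a set \<Rightarrow> 'a set set \<Rightarrow> ('a set \<Rightarrow> real) \<Rightarrow> ('a \<Rightarrow> real) \<Rightarrow> ('a \<Rightarrow> real) \<Rightarrow> real" where
  "hamiltonian V E J h \<sigma> = - (\<Sum>e\<in>E. J e * (\<Prod>x\<in>e. \<sigma> x)) - (\<Sum>x\<in>V. h x * \<sigma> x)"

definition cavity_field ::
  "'a set \<Rightarrow> 'a set set \<Rightarrow> ('a set \<Rightarrow> real) \<Rightarrow> ('a \<Rightarrow> real) \<Rightarrow> ('a \<Rightarrow> real) \<Rightarrow> 'a \<Rightarrow> real" where
  "cavity_field V E J h \<sigma> x = (\<Sum>y\<in>V. coupling E J x y * \<sigma> y) + h x"

definition energy_range ::
  "'a set \<Rightarrow> 'a set set \<Rightarrow> ('a set \<Rightarrow> real) \<Rightarrow> ('a \<Rightarrow> real) \<Rightarrow> real" where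
  "energy_range V E J h =
     Max {\<bar>hamiltonian V E J h \<sigma> - hamiltonian V E J h \<tau>\<bar> | \<sigma> \<tau>.
            \<sigma> \<in> configs V \<and> \<tau> \<in> configs V}"

definition max_cavity_field ::
  "'a set \<Rightarrow> 'a set set \<Rightarrow> ('a set \<Rightarrow> real) \<Rightarrow> ('a \<Rightarrow> real) \<Rightarrow> real" where
  "max_cavity_field V E J h =
     Max {\<bar>cavity_field V E J h \<sigma> x\<bar> | x \<sigma>. x \<in> V \<and> \<sigma> \<in> configs V}"

definition square_sum ::
  "'a set \<Rightarrow> 'a set set \<Rightarrow> ('a set \<Rightarrow> real) \<Rightarrow> ('a \<Rightarrow> real) \<Rightarrow> real" where
  "square_sum V E J h = (\<Sum>e\<in>E. (J e)\<^sup>2) + (\<Sum>x\<in>V. (h x)\<^sup>2)"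

definition flip :: "('a \<Rightarrow> real) \<Rightarrow> 'a \<Rightarrow> ('a \<Rightarrow> real)" where
  "flip \<sigma> x = \<sigma>(x := - \<sigma> x)"

definition gibbs_weight ::
  "'a set \<Rightarrow> 'a set set \<Rightarrow> ('a set \<Rightarrow> real) \<Rightarrow> ('a \<Rightarrow> real) \<Rightarrow> real \<Rightarrow> ('a \<Rightarrow> real) \<Rightarrow> real" where
  "gibbs_weight V E J h \<beta> \<sigma> = exp (- \<beta> * hamiltonian V E J h \<sigma>)"

(* Only meaningful when \<tau> is \<sigma> with one spin flipped. *)
definition glauber_move_prob ::
  "'a set \<Rightarrow> 'a set set \<Rightarrow> ('a set \<Rightarrow> real) \<Rightarrow> ('a \<Rightarrow> real) \<Rightarrow> real \<Rightarrow>
     ('a \<Rightarrow> real) \<Rightarrow> ('a \<Rightarrow> real) \<Rightarrow> real" where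
  "glauber_move_prob V E J h \<beta> \<sigma> \<tau> =
     1 / real (card V) *
       (gibbs_weight V E J h \<beta> \<tau> / (gibbs_weight V E J h \<beta> \<sigma> + gibbs_weight V E J h \<beta> \<tau>))"

definition glauber_kernel ::
  "'a set \<Rightarrow> 'a set set \<Rightarrow> ('a set \<Rightarrow> real) \<Rightarrow> ('a \<Rightarrow> real) \<Rightarrow> real \<Rightarrow>
     ('a \<Rightarrow> real) \<Rightarrow> ('a \<Rightarrow> real) \<Rightarrow> real" where
  "glauber_kernel V E J h \<beta> \<sigma> \<tau> =
     (if \<tau> = \<sigma> then 1 - (\<Sum>x\<in>V. glauber_move_prob V E J h \<beta> \<sigma> (flip \<sigma> x))
      else if \<exists>x\<in>V. \<tau> = flip \<sigma> x then glauber_move_prob V E J h \<beta> \<sigma> \<tau>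
      else 0)"

definition sca_hamiltonian ::
  "'a set \<Rightarrow> 'a set set \<Rightarrow> ('a set \<Rightarrow> real) \<Rightarrow> ('a \<Rightarrow> real) \<Rightarrow>
     ('a \<Rightarrow> real) \<Rightarrow> ('a \<Rightarrow> real) \<Rightarrow> real" where
  "sca_hamiltonian V E J h \<sigma> \<tau> =
     - (1/2) * (\<Sum>x\<in>V. \<Sum>y\<in>V. coupling E J x y * \<sigma> x * \<tau> y)
     - (1/2) * (\<Sum>x\<in>V. h x * (\<sigma> x + \<tau> x))"

definition sca_pair_weight ::
  "'a set \<Rightarrow> 'a set set \<Rightarrow> ('a set \<Rightarrow> real) \<Rightarrow> ('a \<Rightarrow> real) \<Rightarrow> real \<Rightarrow> real \<Rightarrow>
     ('a \<Rightarrow> real) \<Rightarrow> ('a \<Rightarrow> real) \<Rightarrow> real" where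
  "sca_pair_weight V E J h \<beta> q \<sigma> \<tau> =
     exp (- \<beta> * sca_hamiltonian V E J h \<sigma> \<tau> + q * (\<Sum>x\<in>V. \<sigma> x * \<tau> x))"

definition sca_weight ::
  "'a set \<Rightarrow> 'a set set \<Rightarrow> ('a set \<Rightarrow> real) \<Rightarrow> ('a \<Rightarrow> real) \<Rightarrow> real \<Rightarrow> real \<Rightarrow>
     ('a \<Rightarrow> real) \<Rightarrow> real" where
  "sca_weight V E J h \<beta> q \<sigma> = (\<Sum>\<tau>\<in>configs V. sca_pair_weight V E J h \<beta> q \<sigma> \<tau>)"

definition sca_equilibrium ::
  "'a set \<Rightarrow> 'a set set \<Rightarrow> ('a set \<Rightarrow> real) \<Rightarrow> ('a \<Rightarrow> real) \<Rightarrow> real \<Rightarrow> real \<Rightarrow>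
     ('a \<Rightarrow> real) \<Rightarrow> real" where
  "sca_equilibrium V E J h \<beta> q \<sigma> =
     sca_weight V E J h \<beta> q \<sigma> / (\<Sum>\<sigma>'\<in>configs V. sca_weight V E J h \<beta> q \<sigma>')"

definition sca_kernel ::
  "'a set \<Rightarrow> 'a set set \<Rightarrow> ('a set \<Rightarrow> real) \<Rightarrow> ('a \<Rightarrow> real) \<Rightarrow> real \<Rightarrow> real \<Rightarrow>
     ('a \<Rightarrow> real) \<Rightarrow> ('a \<Rightarrow> real) \<Rightarrow> real" where
  "sca_kernel V E J h \<beta> q \<sigma> \<tau> =
     1 / sca_weight V E J h \<beta> q \<sigma> * sca_pair_weight V E J h \<beta> q \<sigma> \<tau>"

definition spin_flips :: "'a set \<Rightarrow> ('a \<Rightarrow> real) \<Rightarrow> ('a \<Rightarrow> real) \<Rightarrow> 'a set" where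
  "spin_flips V \<sigma> \<tau> = {x \<in> V. \<sigma> x \<noteq> \<tau> x}"

definition expected_spin_flips ::
  "'a set \<Rightarrow> (('a \<Rightarrow> real) \<Rightarrow> ('a \<Rightarrow> real) \<Rightarrow> real) \<Rightarrow> ('a \<Rightarrow> real) \<Rightarrow> real" where
  "expected_spin_flips V P \<sigma> = (\<Sum>\<tau>\<in>configs V. real (card (spin_flips V \<sigma> \<tau>)) * P \<sigma> \<tau>)"

definition prob_on_configs :: "'a set \<Rightarrow> (('a \<Rightarrow> real) \<Rightarrow> real) \<Rightarrow> bool" where
  "prob_on_configs V \<mu> \<longleftrightarrow> (\<forall>\<sigma>\<in>configs V. 0 \<le> \<mu> \<sigma>) \<and> (\<Sum>\<sigma>\<in>configs V. \<mu> \<sigma>) = 1"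

(* Closeness of \<mu> to the Gibbs distribution in the sense of order-preservation. The target
   enters only through its Hamiltonian, so the inverse temperature does not appear. *)
definition order_close ::
  "'a set \<Rightarrow> 'a set set \<Rightarrow> ('a set \<Rightarrow> real) \<Rightarrow> ('a \<Rightarrow> real) \<Rightarrow> real \<Rightarrow>
     (('a \<Rightarrow> real) \<Rightarrow> real) \<Rightarrow> bool" where
  "order_close V E J h \<epsilon> \<mu> \<longleftrightarrow>
     prob_on_configs V \<mu> \<and>
     (\<forall>\<sigma>\<in>configs V. \<forall>\<tau>\<in>configs V. \<mu> \<sigma> \<ge> \<mu> \<tau> \<longrightarrow>
        hamiltonian V E J h \<sigma> \<le> hamiltonian V E J h \<tau> + \<epsilon> * energy_range V E J h)"

end

theory Submission
  imports Defs
begin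

text \<open>
  Write \<open>a\<^sub>x = \<sigma>\<^sub>x h'\<^sub>x(\<sigma>)\<close> for the cavity field at \<open>x\<close> measured along the spin at \<open>x\<close>, \<open>n\<close> for the
  number of vertices and \<open>K\<close> for the largest absolute cavity field. From \<open>\<sigma>\<close>, the Glauber chain flips \<open>x\<close> with
  probability \<open>1 / (n (1 + exp (2 \<beta> a\<^sub>x)))\<close>, whereas the cellular automaton updates all spins
  independently and flips \<open>x\<close> with probability \<open>1 / (1 + exp (\<beta> a\<^sub>x + 2 q))\<close>
  (\<open>expected_spin_flips_glauber\<close>, \<open>expected_spin_flips_sca\<close>). The first claim asks for small \<open>q\<close>
  and the second for large \<open>q\<close>. For positive \<open>\<beta>\<close> the choice \<open>exp (2 q) = n\<close> serves both.

  Speed: with \<open>t = exp (\<beta> a\<^sub>x)\<close>, the flip probabilities are already ordered at each vertex, because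
  \<open>1 + n t \<le> n (1 + t\<^sup>2)\<close> holds for every \<open>t\<close> once \<open>n \<ge> 2\<close>.

  Order: summing out the second configuration factorises the weight of the automaton as
  \<open>exp (n q) exp (- \<beta> H(\<sigma>)) \<Prod>\<^sub>x (1 + exp (- 2 q - \<beta> a\<^sub>x))\<close> (\<open>sca_weight_eq\<close>). Only the
  last product distorts the Gibbs order. Each of its factors varies by a ratio of at most
  \<open>exp (2 \<beta> K exp (\<beta> K) exp (- 2 q))\<close>. As \<open>n exp (- 2 q) = 1\<close>, a configuration of larger weight has an
  energy exceeding that of the other one by at most \<open>2 K exp (\<beta> K)\<close> (\<open>sca_order_energy_bound\<close>).
  The hypothesis on \<open>\<beta>\<close> bounds this by \<open>\<epsilon> sqrt v\<close>.

  Range: under the uniform measure the energy has mean zero and second moment \<open>v\<close>, because products of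
  spins over distinct vertex sets are orthogonal. Hence \<open>sqrt v\<close> is at most the range of the energy
  (\<open>sqrt_square_sum_le_energy_range\<close>).

  At \<open>\<beta> = 0\<close> the pinning \<open>q = 0\<close> works: every spin of the automaton flips with probability one half,
  and \<open>\<epsilon> \<ge> 1\<close> makes the order condition the definition of the range.
\<close>

section \<open>Configurations and spin flips\<close>

lemma finite_configs: "finite V \<Longrightarrow> finite (configs V)"
  by (simp add: configs_def finite_PiE)

lemma configs_nonempty: "configs V \<noteq> {}"
  by (simp add: configs_def PiE_eq_empty_iff)

lemma spin_cases: "\<sigma> \<in> configs V \<Longrightarrow> x \<in> V \<Longrightarrow> \<sigma> x = 1 \<or> \<sigma> x = -1"
  by (auto simp: configs_def PiE_def Pi_def)

lemma spin_mult_self: "\<sigma> \<in> configs V \<Longrightarrow> x \<in> V \<Longrightarrow> \<sigma> x * \<sigma> x = 1"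
  using spin_cases[of \<sigma> V x] by auto

lemma flip_in_configs: "\<sigma> \<in> configs V \<Longrightarrow> x \<in> V \<Longrightarrow> flip \<sigma> x \<in> configs V"
  by (auto simp: configs_def flip_def PiE_def Pi_def extensional_def)

lemma flip_flip [simp]: "flip (flip \<sigma> x) x = \<sigma>"
  by (auto simp: flip_def)

lemma flip_apply: "flip \<sigma> x y = (if y = x then - \<sigma> x else \<sigma> y)"
  by (simp add: flip_def)

lemma spin_flips_flip:
  assumes "\<sigma> \<in> configs V" "x \<in> V"
  shows "spin_flips V \<sigma> (flip \<sigma> x) = {x}"
  using assms spin_cases[OF assms] by (auto simp: spin_flips_def flip_apply split: if_splits)

lemma flip_neq:
  assumes "\<sigma> \<in> configs V" "x \<in> V"
  shows "flip \<sigma> x \<noteq> \<sigma>"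
  using spin_flips_flip[OF assms] by (auto simp: spin_flips_def)

lemma inj_on_flip:
  assumes "\<sigma> \<in> configs V"
  shows "inj_on (flip \<sigma>) V"
  by (rule inj_onI) (metis spin_flips_flip[OF assms] singleton_inject)

lemma sum_configs_flip:
  assumes "x \<in> V"
  shows "(\<Sum>\<sigma>\<in>configs V. f (flip \<sigma> x)) = (\<Sum>\<sigma>\<in>configs V. f \<sigma>)"
  by (rule sum.reindex_bij_witness[of _ "\<lambda>\<sigma>. flip \<sigma> x" "\<lambda>\<sigma>. flip \<sigma> x"])
    (auto intro: flip_in_configs assms)

section \<open>Cavity fields and the symmetric two-configuration Hamiltonian\<close>

lemma coupling_sym: "coupling E J x y = coupling E J y x"
  by (simp add: coupling_def insert_commute)

lemma coupling_self:
  assumes "simple_graph V E"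
  shows "coupling E J x x = 0"
  using assms by (force simp: simple_graph_def coupling_def)

lemma cavity_field_flip:
  assumes "simple_graph V E"
  shows "cavity_field V E J h (flip \<sigma> x) x = cavity_field V E J h \<sigma> x"
proof -
  have "coupling E J x y * flip \<sigma> x y = coupling E J x y * \<sigma> y" for y
    by (cases "y = x") (simp_all add: coupling_self[OF assms] flip_apply)
  then show ?thesis by (simp only: cavity_field_def)
qed

lemma sca_hamiltonian_sym:
  "sca_hamiltonian V E J h \<sigma> \<tau> = sca_hamiltonian V E J h \<tau> \<sigma>"
proof -
  have "(\<Sum>x\<in>V. \<Sum>y\<in>V. coupling E J x y * \<sigma> x * \<tau> y) =
        (\<Sum>y\<in>V. \<Sum>x\<in>V. coupling E J x y * \<sigma> x * \<tau> y)"
    by (rule sum.swap)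
  also have "\<dots> = (\<Sum>x\<in>V. \<Sum>y\<in>V. coupling E J x y * \<tau> x * \<sigma> y)"
    by (intro sum.cong refl) (simp add: coupling_sym[of E J] mult_ac)
  finally show ?thesis by (simp add: sca_hamiltonian_def add.commute)
qed

text \<open>
  For a fixed first configuration, the energy is affine in the second one, and up to the factor \<open>- 1/2\<close>
  its coefficients are the cavity fields. This is why the automaton updates its spins independently.
\<close>

lemma sca_hamiltonian_cavity:
  "sca_hamiltonian V E J h \<sigma> \<tau> =
     - (1/2) * (\<Sum>x\<in>V. \<tau> x * cavity_field V E J h \<sigma> x) - (1/2) * (\<Sum>x\<in>V. h x * \<sigma> x)"
proof -
  have "(\<Sum>x\<in>V. \<tau> x * cavity_field V E J h \<sigma> x) =
      (\<Sum>x\<in>V. \<Sum>y\<in>V. coupling E J x y * \<tau> x * \<sigma> y) + (\<Sum>x\<in>V. h x * \<tau> x)"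
    by (simp add: cavity_field_def distrib_left sum.distrib sum_distrib_left mult_ac)
  then show ?thesis
    unfolding sca_hamiltonian_sym[of V E J h \<sigma> \<tau>]
    unfolding sca_hamiltonian_def
    by (simp add: sum.distrib algebra_simps)
qed

text \<open>
  Each edge is counted once for each of its two orientations.
\<close>

lemma sum_coupling_eq_twice_sum_edges:
  assumes "simple_graph V E"
  shows "(\<Sum>x\<in>V. \<Sum>y\<in>V. coupling E J x y * \<sigma> x * \<sigma> y) = 2 * (\<Sum>e\<in>E. J e * prod \<sigma> e)"
proof -
  have finV: "finite V" and sub: "\<And>e. e \<in> E \<Longrightarrow> e \<subseteq> V" and card: "\<And>e. e \<in> E \<Longrightarrow> card e = 2"
    using assms by (auto simp: simple_graph_def)
  have finE: "finite E"
    using finite_subset[of E "Pow V"] sub finV by auto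
  have edge: "(\<Sum>p | p \<in> V \<times> V \<and> {fst p, snd p} = e. J e * \<sigma> (fst p) * \<sigma> (snd p))
      = 2 * (J e * prod \<sigma> e)" if e: "e \<in> E" for e
  proof -
    obtain a b where ab: "e = {a, b}" "a \<noteq> b"
      using card[OF e] by (auto simp: card_2_iff)
    have "{p. p \<in> V \<times> V \<and> {fst p, snd p} = e} = {(a, b), (b, a)}"
      using sub[OF e] ab by (auto simp: doubleton_eq_iff)
    then show ?thesis using ab by (simp add: algebra_simps)
  qed
  have "(\<Sum>x\<in>V. \<Sum>y\<in>V. coupling E J x y * \<sigma> x * \<sigma> y)
      = (\<Sum>p\<in>V \<times> V. coupling E J (fst p) (snd p) * \<sigma> (fst p) * \<sigma> (snd p))"
    by (simp add: sum.cartesian_product case_prod_beta)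
  also have "\<dots> = (\<Sum>p\<in>{p \<in> V \<times> V. {fst p, snd p} \<in> E}.
      J {fst p, snd p} * \<sigma> (fst p) * \<sigma> (snd p))"
    using finV by (intro sum.mono_neutral_cong_right) (auto simp: coupling_def)
  also have "\<dots> = (\<Sum>e\<in>E. \<Sum>p | p \<in> {p \<in> V \<times> V. {fst p, snd p} \<in> E} \<and> {fst p, snd p} = e.
      J {fst p, snd p} * \<sigma> (fst p) * \<sigma> (snd p))"
    using finV finE by (intro sum.group[symmetric]) auto
  also have "\<dots> = (\<Sum>e\<in>E. \<Sum>p | p \<in> V \<times> V \<and> {fst p, snd p} = e. J e * \<sigma> (fst p) * \<sigma> (snd p))"
    by (intro sum.cong refl) auto
  also have "\<dots> = 2 * (\<Sum>e\<in>E. J e * prod \<sigma> e)"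
    by (simp add: edge sum_distrib_left)
  finally show ?thesis .
qed

lemma sca_hamiltonian_diag:
  assumes "simple_graph V E"
  shows "sca_hamiltonian V E J h \<sigma> \<sigma> = hamiltonian V E J h \<sigma>"
proof -
  have "(\<Sum>x\<in>V. h x * (\<sigma> x + \<sigma> x)) = 2 * (\<Sum>x\<in>V. h x * \<sigma> x)"
    by (simp add: sum_distrib_left mult_2[symmetric] mult_ac)
  then show ?thesis
    by (simp add: sca_hamiltonian_def hamiltonian_def sum_coupling_eq_twice_sum_edges[OF assms])
qed

lemma sca_hamiltonian_flip:
  assumes "finite V" "x \<in> V"
  shows "sca_hamiltonian V E J h \<sigma> (flip \<tau> x) =
    sca_hamiltonian V E J h \<sigma> \<tau> + \<tau> x * cavity_field V E J h \<sigma> x"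
proof -
  let ?c = "cavity_field V E J h \<sigma>"
  have "(\<Sum>y\<in>V. flip \<tau> x y * ?c y) = - \<tau> x * ?c x + (\<Sum>y\<in>V - {x}. flip \<tau> x y * ?c y)"
    using assms by (simp add: sum.remove[of V x] flip_apply)
  also have "(\<Sum>y\<in>V - {x}. flip \<tau> x y * ?c y) = (\<Sum>y\<in>V - {x}. \<tau> y * ?c y)"
    by (intro sum.cong) (auto simp: flip_apply)
  finally have "(\<Sum>y\<in>V. flip \<tau> x y * ?c y) = (\<Sum>y\<in>V. \<tau> y * ?c y) - 2 * (\<tau> x * ?c x)"
    using assms by (simp add: sum.remove[of V x])
  then show ?thesis by (simp add: sca_hamiltonian_cavity algebra_simps)
qed

text \<open>
  Flipping both arguments of the symmetric two-configuration Hamiltonian in turn costs the same amount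
  each time, since the cavity field at \<open>x\<close> does not see the spin at \<open>x\<close>. This avoids any bookkeeping
  of the edges incident to \<open>x\<close>.
\<close>

lemma hamiltonian_flip:
  assumes "simple_graph V E" "x \<in> V"
  shows "hamiltonian V E J h (flip \<sigma> x) =
    hamiltonian V E J h \<sigma> + 2 * (\<sigma> x * cavity_field V E J h \<sigma> x)"
proof -
  let ?H = "sca_hamiltonian V E J h"
  have finV: "finite V" using assms by (simp add: simple_graph_def)
  have "?H (flip \<sigma> x) (flip \<sigma> x) = ?H (flip \<sigma> x) \<sigma> + \<sigma> x * cavity_field V E J h \<sigma> x"
    by (simp add: sca_hamiltonian_flip[OF finV assms(2)] cavity_field_flip[OF assms(1)])
  also have "?H (flip \<sigma> x) \<sigma> = ?H \<sigma> \<sigma> + \<sigma> x * cavity_field V E J h \<sigma> x"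
    by (simp add: sca_hamiltonian_sym[of V E J h "flip \<sigma> x"] sca_hamiltonian_flip[OF finV assms(2)])
  finally show ?thesis by (simp add: sca_hamiltonian_diag[OF assms(1)])
qed

section \<open>Expected numbers of spin-flips\<close>

text \<open>
  The chain moves to a single-flip neighbour or stays, so the expectation is the total probability of
  moving, and the ratio of Gibbs weights is the Boltzmann factor of the energy change.
\<close>

lemma expected_spin_flips_glauber:
  assumes "simple_graph V E" "\<sigma> \<in> configs V"
  shows "expected_spin_flips V (glauber_kernel V E J h \<beta>) \<sigma> =
    (\<Sum>x\<in>V. 1 / real (card V) * (1 / (1 + exp (2 * (\<beta> * (\<sigma> x * cavity_field V E J h \<sigma> x))))))"
proof -
  let ?K = "glauber_kernel V E J h \<beta>"
  have finV: "finite V" using assms by (simp add: simple_graph_def)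
  have "expected_spin_flips V ?K \<sigma> =
      (\<Sum>\<tau>\<in>flip \<sigma> ` V. real (card (spin_flips V \<sigma> \<tau>)) * ?K \<sigma> \<tau>)"
    unfolding expected_spin_flips_def
  proof (rule sum.mono_neutral_right)
    show "finite (configs V)" by (rule finite_configs[OF finV])
    show "flip \<sigma> ` V \<subseteq> configs V" using flip_in_configs[OF assms(2)] by auto
    show "\<forall>\<tau>\<in>configs V - flip \<sigma> ` V. real (card (spin_flips V \<sigma> \<tau>)) * ?K \<sigma> \<tau> = 0"
      by (auto simp: glauber_kernel_def spin_flips_def)
  qed
  also have "\<dots> = (\<Sum>x\<in>V. real (card (spin_flips V \<sigma> (flip \<sigma> x))) * ?K \<sigma> (flip \<sigma> x))"
    by (simp add: sum.reindex[OF inj_on_flip[OF assms(2)]])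
  also have "\<dots> = (\<Sum>x\<in>V. glauber_move_prob V E J h \<beta> \<sigma> (flip \<sigma> x))"
  proof (rule sum.cong[OF refl])
    fix x assume x: "x \<in> V"
    show "real (card (spin_flips V \<sigma> (flip \<sigma> x))) * ?K \<sigma> (flip \<sigma> x)
        = glauber_move_prob V E J h \<beta> \<sigma> (flip \<sigma> x)"
      using x flip_neq[OF assms(2) x] by (auto simp: spin_flips_flip[OF assms(2) x] glauber_kernel_def)
  qed
  also have "\<dots> = (\<Sum>x\<in>V. 1 / real (card V) *
      (1 / (1 + exp (2 * (\<beta> * (\<sigma> x * cavity_field V E J h \<sigma> x))))))"
  proof (rule sum.cong[OF refl])
    fix x assume x: "x \<in> V"
    define c where "c = 2 * (\<beta> * (\<sigma> x * cavity_field V E J h \<sigma> x))"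
    define w where "w = gibbs_weight V E J h \<beta> (flip \<sigma> x)"
    have "w > 0" by (simp add: w_def gibbs_weight_def)
    have "gibbs_weight V E J h \<beta> \<sigma> = w * exp c"
      by (simp add: w_def gibbs_weight_def hamiltonian_flip[OF assms(1) x] c_def
          exp_add[symmetric] algebra_simps)
    then have "w / (gibbs_weight V E J h \<beta> \<sigma> + w) = 1 / (1 + exp c)"
      using \<open>w > 0\<close> by (simp add: divide_simps add_pos_pos add_nonneg_eq_0_iff) (simp add: algebra_simps)
    then show "glauber_move_prob V E J h \<beta> \<sigma> (flip \<sigma> x) = 1 / real (card V) *
      (1 / (1 + exp (2 * (\<beta> * (\<sigma> x * cavity_field V E J h \<sigma> x)))))"
      by (simp add: glauber_move_prob_def w_def c_def)
  qed
  finally show ?thesis .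
qed

lemma sca_weight_pos:
  assumes "finite V"
  shows "sca_weight V E J h \<beta> q \<sigma> > 0"
  unfolding sca_weight_def
  by (rule sum_pos[OF finite_configs[OF assms] configs_nonempty]) (simp add: sca_pair_weight_def)

lemma sca_pair_weight_flip:
  assumes "finite V" "x \<in> V"
  shows "sca_pair_weight V E J h \<beta> q \<sigma> (flip \<tau> x) =
    sca_pair_weight V E J h \<beta> q \<sigma> \<tau> * exp (- \<tau> x * (\<beta> * cavity_field V E J h \<sigma> x + 2 * q * \<sigma> x))"
proof -
  have "(\<Sum>y\<in>V. \<sigma> y * flip \<tau> x y) = - \<sigma> x * \<tau> x + (\<Sum>y\<in>V - {x}. \<sigma> y * flip \<tau> x y)"
    using assms by (simp add: sum.remove[of V x] flip_apply)
  also have "(\<Sum>y\<in>V - {x}. \<sigma> y * flip \<tau> x y) = (\<Sum>y\<in>V - {x}. \<sigma> y * \<tau> y)"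
    by (intro sum.cong) (auto simp: flip_apply)
  finally have overlap: "(\<Sum>y\<in>V. \<sigma> y * flip \<tau> x y) = (\<Sum>y\<in>V. \<sigma> y * \<tau> y) - 2 * (\<sigma> x * \<tau> x)"
    using assms by (simp add: sum.remove[of V x])
  show ?thesis
    unfolding sca_pair_weight_def sca_hamiltonian_flip[OF assms] overlap exp_add[symmetric]
    by (simp add: algebra_simps)
qed

text \<open>
  Flipping the second configuration at \<open>x\<close> is a bijection between those that agree with \<open>\<sigma>\<close> at \<open>x\<close> and
  those that do not. It multiplies the pair weight by one and the same factor, which fixes the split of
  the total weight between the two classes.
\<close>

lemma sca_flip_mass:
  assumes "finite V" "\<sigma> \<in> configs V" "x \<in> V"
  shows "(\<Sum>\<tau> | \<tau> \<in> configs V \<and> \<sigma> x \<noteq> \<tau> x. sca_pair_weight V E J h \<beta> q \<sigma> \<tau>) =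
    sca_weight V E J h \<beta> q \<sigma> / (1 + exp (\<beta> * (\<sigma> x * cavity_field V E J h \<sigma> x) + 2 * q))"
proof -
  let ?W = "sca_pair_weight V E J h \<beta> q \<sigma>"
  define c where "c = \<beta> * (\<sigma> x * cavity_field V E J h \<sigma> x) + 2 * q"
  define A where "A = (\<Sum>\<tau> | \<tau> \<in> configs V \<and> \<sigma> x = \<tau> x. ?W \<tau>)"
  define B where "B = (\<Sum>\<tau> | \<tau> \<in> configs V \<and> \<sigma> x \<noteq> \<tau> x. ?W \<tau>)"
  have "B = (\<Sum>\<tau> | \<tau> \<in> configs V \<and> \<sigma> x = \<tau> x. ?W (flip \<tau> x))"
    unfolding B_def
  proof (rule sum.reindex_bij_witness[of _ "\<lambda>\<tau>. flip \<tau> x" "\<lambda>\<tau>. flip \<tau> x"])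
    have opposite: "\<sigma> x = flip \<tau> x x \<longleftrightarrow> \<sigma> x \<noteq> \<tau> x" if "\<tau> \<in> configs V" for \<tau>
      using spin_cases[OF assms(2,3)] spin_cases[OF that assms(3)] by (auto simp: flip_apply)
    show "flip \<tau> x \<in> {\<tau> \<in> configs V. \<sigma> x = \<tau> x}" if "\<tau> \<in> {\<tau> \<in> configs V. \<sigma> x \<noteq> \<tau> x}" for \<tau>
      using that opposite[of \<tau>] flip_in_configs[OF _ assms(3), of \<tau>] by auto
    show "flip \<tau> x \<in> {\<tau> \<in> configs V. \<sigma> x \<noteq> \<tau> x}" if "\<tau> \<in> {\<tau> \<in> configs V. \<sigma> x = \<tau> x}" for \<tau>
      using that opposite[of \<tau>] flip_in_configs[OF _ assms(3), of \<tau>] by auto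
  qed simp_all
  also have "\<dots> = (\<Sum>\<tau> | \<tau> \<in> configs V \<and> \<sigma> x = \<tau> x. ?W \<tau> * exp (- c))"
  proof (rule sum.cong[OF refl])
    fix \<tau> assume "\<tau> \<in> {\<tau> \<in> configs V. \<sigma> x = \<tau> x}"
    then have "- \<tau> x * (\<beta> * cavity_field V E J h \<sigma> x + 2 * q * \<sigma> x) = - c"
      using spin_cases[OF assms(2,3)] by (auto simp: c_def)
    then show "?W (flip \<tau> x) = ?W \<tau> * exp (- c)"
      by (simp only: sca_pair_weight_flip[OF assms(1,3)])
  qed
  finally have BA: "B = A * exp (- c)" by (simp add: A_def sum_distrib_right)
  have "sca_weight V E J h \<beta> q \<sigma> = A + B"
    unfolding sca_weight_def A_def B_def
    by (subst sum.union_disjoint[symmetric])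
      (auto simp: finite_configs[OF assms(1)] intro!: sum.cong)
  moreover have "A = B * exp c" using BA by (simp add: exp_minus)
  ultimately have "sca_weight V E J h \<beta> q \<sigma> = B * (1 + exp c)"
    by (simp add: algebra_simps)
  moreover have "1 + exp c \<noteq> 0" using exp_gt_zero[of c] by linarith
  ultimately show ?thesis by (simp add: B_def[symmetric] c_def[symmetric])
qed

text \<open>
  Linearity of expectation over the vertices.
\<close>

lemma expected_spin_flips_sca:
  assumes "finite V" "\<sigma> \<in> configs V"
  shows "expected_spin_flips V (sca_kernel V E J h \<beta> q) \<sigma> =
    (\<Sum>x\<in>V. 1 / (1 + exp (\<beta> * (\<sigma> x * cavity_field V E J h \<sigma> x) + 2 * q)))"
proof -
  let ?w = "sca_weight V E J h \<beta> q \<sigma>" and ?W = "sca_pair_weight V E J h \<beta> q \<sigma>"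
  have "expected_spin_flips V (sca_kernel V E J h \<beta> q) \<sigma> =
      (\<Sum>\<tau>\<in>configs V. \<Sum>x\<in>V. if \<sigma> x \<noteq> \<tau> x then ?W \<tau> / ?w else 0)"
    using assms(1)
    by (simp add: expected_spin_flips_def spin_flips_def sca_kernel_def sum.If_cases Int_def)
  also have "\<dots> = (\<Sum>x\<in>V. \<Sum>\<tau>\<in>configs V. if \<sigma> x \<noteq> \<tau> x then ?W \<tau> / ?w else 0)"
    by (rule sum.swap)
  also have "\<dots> = (\<Sum>x\<in>V. (\<Sum>\<tau> | \<tau> \<in> configs V \<and> \<sigma> x \<noteq> \<tau> x. ?W \<tau>) / ?w)"
    by (simp add: sum.If_cases finite_configs[OF assms(1)] Int_def sum_divide_distrib)
  also have "\<dots> = (\<Sum>x\<in>V. 1 / (1 + exp (\<beta> * (\<sigma> x * cavity_field V E J h \<sigma> x) + 2 * q)))"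
    using sca_weight_pos[OF assms(1), of E J h \<beta> q \<sigma>]
    by (intro sum.cong refl) (simp add: sca_flip_mass[OF assms])
  finally show ?thesis .
qed

text \<open>
  The comparison of flip probabilities at one vertex, with \<open>t = exp (\<beta> a\<^sub>x)\<close> and \<open>exp (2 q) = n\<close>. It
  reduces to \<open>n t\<^sup>2 - n t + (n - 1) \<ge> 0\<close>, which is \<open>n (t - 1/2)\<^sup>2 + (3 n / 4 - 1)\<close>.
\<close>

lemma glauber_flip_rate_le:
  fixes t :: real
  assumes "t > 0" "n \<ge> 2"
  shows "1 / n * (1 / (1 + t\<^sup>2)) \<le> 1 / (1 + t * n)"
proof -
  have "n * (t - 1/2)\<^sup>2 \<ge> 0" using assms by simp
  then have "1 + t * n \<le> n * (1 + t\<^sup>2)"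
    using assms(2) by (simp add: power2_eq_square algebra_simps)
  moreover have "0 < 1 + t * n" using assms by (simp add: add_pos_pos)
  ultimately show ?thesis using frac_le[of 1 1 "1 + t * n" "n * (1 + t\<^sup>2)"] by simp
qed

lemma sca_flips_at_least_glauber:
  assumes "simple_graph V E" "\<sigma> \<in> configs V" "card V \<ge> 2"
  shows "expected_spin_flips V (glauber_kernel V E J h \<beta>) \<sigma>
    \<le> expected_spin_flips V (sca_kernel V E J h \<beta> (ln (card V) / 2)) \<sigma>"
proof -
  have finV: "finite V" using assms by (simp add: simple_graph_def)
  show ?thesis
    unfolding expected_spin_flips_glauber[OF assms(1,2)] expected_spin_flips_sca[OF finV assms(2)]
  proof (rule sum_mono)
    fix x
    let ?a = "\<beta> * (\<sigma> x * cavity_field V E J h \<sigma> x)"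
    have "exp (?a + 2 * (ln (card V) / 2)) = exp ?a * card V"
      using assms(3) by (simp add: exp_add)
    moreover have "exp (2 * ?a) = (exp ?a)\<^sup>2" by (simp add: exp_double)
    ultimately show "1 / real (card V) * (1 / (1 + exp (2 * ?a)))
        \<le> 1 / (1 + exp (?a + 2 * (ln (card V) / 2)))"
      using glauber_flip_rate_le[of "exp ?a" "card V"] assms(3) by simp
  qed
qed

section \<open>The equilibrium of the cellular automaton\<close>

text \<open>
  The sum over the second configuration factorises over the vertices into terms \<open>2 cosh (q + \<beta> a\<^sub>x / 2)\<close>.
  Taking \<open>exp (q + \<beta> a\<^sub>x / 2)\<close> out of each of them recovers exactly the Gibbs weight, because the
  aligned fields count every edge twice and every local field once, and the prefactor supplies the
  missing half of the local-field term.
\<close>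

lemma sca_weight_eq:
  assumes "simple_graph V E" "\<sigma> \<in> configs V"
  shows "sca_weight V E J h \<beta> q \<sigma> =
    exp (real (card V) * q) * (exp (- \<beta> * hamiltonian V E J h \<sigma>) *
      (\<Prod>x\<in>V. 1 + exp (- 2 * q - \<beta> * (\<sigma> x * cavity_field V E J h \<sigma> x))))"
proof -
  have finV: "finite V" using assms by (simp add: simple_graph_def)
  let ?c = "cavity_field V E J h \<sigma>"
  let ?f = "\<lambda>x. \<beta> / 2 * ?c x + q * \<sigma> x"
  let ?a = "\<lambda>x. \<beta> * (\<sigma> x * ?c x)"
  have W: "sca_pair_weight V E J h \<beta> q \<sigma> \<tau> =
      exp (\<beta> / 2 * (\<Sum>x\<in>V. h x * \<sigma> x)) * (\<Prod>x\<in>V. exp (\<tau> x * ?f x))" for \<tau>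
  proof -
    have "- \<beta> * sca_hamiltonian V E J h \<sigma> \<tau> + q * (\<Sum>x\<in>V. \<sigma> x * \<tau> x)
        = \<beta> / 2 * (\<Sum>x\<in>V. h x * \<sigma> x) + (\<Sum>x\<in>V. \<tau> x * ?f x)"
      by (simp add: sca_hamiltonian_cavity sum.distrib sum_distrib_left sum_negf algebra_simps)
    then show ?thesis
      unfolding sca_pair_weight_def by (simp only: exp_add exp_sum[OF finV])
  qed
  have "(\<Sum>\<tau>\<in>configs V. \<Prod>x\<in>V. exp (\<tau> x * ?f x)) = (\<Prod>x\<in>V. \<Sum>s\<in>{1, -1}. exp (s * ?f x))"
    unfolding configs_def by (rule prod_sum_PiE[symmetric]) (simp_all add: finV)
  also have "\<dots> = (\<Prod>x\<in>V. exp (q + ?a x / 2) * (1 + exp (- 2 * q - ?a x)))"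
  proof (rule prod.cong[OF refl])
    fix x assume x: "x \<in> V"
    have "exp (q + ?a x / 2) * (1 + exp (- 2 * q - ?a x)) = exp (q + ?a x / 2) + exp (- (q + ?a x / 2))"
      by (simp add: distrib_left exp_add[symmetric] algebra_simps)
    also have "\<dots> = exp (?f x) + exp (- ?f x)"
      using spin_cases[OF assms(2) x] by (auto simp: algebra_simps)
    finally show "(\<Sum>s\<in>{1, -1}. exp (s * ?f x)) = exp (q + ?a x / 2) * (1 + exp (- 2 * q - ?a x))"
      by simp
  qed
  also have "\<dots> = exp (card V * q + (\<Sum>x\<in>V. ?a x) / 2) * (\<Prod>x\<in>V. 1 + exp (- 2 * q - ?a x))"
    by (simp add: prod.distrib exp_sum[OF finV, symmetric] sum.distrib sum_divide_distrib)
  finally have "sca_weight V E J h \<beta> q \<sigma> = exp (\<beta> / 2 * (\<Sum>x\<in>V. h x * \<sigma> x)) *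
      (exp (card V * q + (\<Sum>x\<in>V. ?a x) / 2) * (\<Prod>x\<in>V. 1 + exp (- 2 * q - ?a x)))"
    by (simp only: sca_weight_def W sum_distrib_left[symmetric])
  moreover have "\<beta> / 2 * (\<Sum>x\<in>V. h x * \<sigma> x) + (card V * q + (\<Sum>x\<in>V. ?a x) / 2)
      = card V * q + - \<beta> * hamiltonian V E J h \<sigma>"
  proof -
    have "(\<Sum>x\<in>V. ?a x) = \<beta> * (\<Sum>x\<in>V. \<sigma> x * ?c x)"
      by (rule sum_distrib_left[symmetric])
    moreover have "hamiltonian V E J h \<sigma> =
        - (1/2) * (\<Sum>x\<in>V. \<sigma> x * ?c x) - (1/2) * (\<Sum>x\<in>V. h x * \<sigma> x)"
      by (simp only: sca_hamiltonian_diag[OF assms(1), symmetric] sca_hamiltonian_cavity)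
    ultimately show ?thesis by algebra
  qed
  ultimately show ?thesis
    by (simp only: mult.assoc[symmetric] exp_add[symmetric])
qed

text \<open>
  The two exponentials differ by at most \<open>exp S - exp (- S) \<le> 2 S exp S\<close>, and \<open>1 + A\<close> is at most
  \<open>(1 + d) (1 + B) \<le> exp d (1 + B)\<close> whenever \<open>A \<le> B + d\<close> with \<open>B\<close> and \<open>d\<close> nonnegative.
\<close>

lemma one_plus_exp_ratio_bound:
  fixes u S s s' :: real
  assumes "u \<ge> 0" "\<bar>s\<bar> \<le> S" "\<bar>s'\<bar> \<le> S"
  shows "1 + u * exp (- s) \<le> exp (2 * S * u * exp S) * (1 + u * exp (- s'))"
proof -
  let ?A = "u * exp (- s)" and ?B = "u * exp (- s')" and ?d = "2 * S * u * exp S"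
  have "1 - exp (- 2 * S) \<le> 2 * S"
    using exp_ge_add_one_self[of "- 2 * S"] by simp
  then have "u * exp S * (1 - exp (- 2 * S)) \<le> u * exp S * (2 * S)"
    using assms by (intro mult_left_mono) auto
  moreover have "exp S * exp (- 2 * S) = exp (- S)" by (simp add: exp_add[symmetric])
  ultimately have "u * exp S - u * exp (- S) \<le> ?d" by (simp add: algebra_simps)
  moreover have "?A \<le> u * exp S" "u * exp (- S) \<le> ?B"
    using assms by (auto intro!: mult_left_mono)
  ultimately have AB: "?A \<le> ?B + ?d" by linarith
  have d: "?d \<ge> 0" and B: "?B \<ge> 0" using assms by auto
  have "1 + ?A \<le> (1 + ?d) * (1 + ?B)"
    using AB mult_nonneg_nonneg[OF d B] by (simp add: algebra_simps)
  also have "\<dots> \<le> exp ?d * (1 + ?B)"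
    using exp_ge_add_one_self[of ?d] B by (intro mult_right_mono) auto
  finally show ?thesis .
qed

lemma abs_cavity_field_le_max:
  assumes "finite V" "\<sigma> \<in> configs V" "x \<in> V"
  shows "\<bar>cavity_field V E J h \<sigma> x\<bar> \<le> max_cavity_field V E J h"
proof -
  have eq: "{\<bar>cavity_field V E J h \<sigma> x\<bar> | x \<sigma>. x \<in> V \<and> \<sigma> \<in> configs V}
      = (\<lambda>(x, \<sigma>). \<bar>cavity_field V E J h \<sigma> x\<bar>) ` (V \<times> configs V)" by auto
  show ?thesis
    unfolding max_cavity_field_def eq
    by (rule Max_ge) (use assms finite_configs[OF assms(1)] in \<open>auto simp: image_iff\<close>)
qed

text \<open>
  The two Gibbs factors can be ordered differently from the weights only by as much as the correction
  products differ, and this is controlled factor by factor.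
\<close>

lemma sca_order_energy_bound:
  assumes graph: "simple_graph V E" and \<sigma>: "\<sigma> \<in> configs V" and \<tau>: "\<tau> \<in> configs V"
    and \<beta>: "\<beta> > 0"
    and le: "sca_weight V E J h \<beta> q \<tau> \<le> sca_weight V E J h \<beta> q \<sigma>"
  shows "hamiltonian V E J h \<sigma> \<le> hamiltonian V E J h \<tau> +
    card V * exp (- 2 * q) * (2 * max_cavity_field V E J h * exp (\<beta> * max_cavity_field V E J h))"
proof -
  have finV: "finite V" using graph by (simp add: simple_graph_def)
  let ?H = "hamiltonian V E J h"
  define S where "S = \<beta> * max_cavity_field V E J h"
  define d where "d = 2 * S * exp (- 2 * q) * exp S"
  define a where "a = (\<lambda>\<rho> x. \<beta> * (\<rho> x * cavity_field V E J h \<rho> x))"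
  define Z where "Z = (\<lambda>\<rho>. \<Prod>x\<in>V. 1 + exp (- 2 * q) * exp (- a \<rho> x))"
  have a_le: "\<bar>a \<rho> x\<bar> \<le> S" if "\<rho> \<in> configs V" "x \<in> V" for \<rho> x
    using spin_cases[OF that] abs_cavity_field_le_max[OF finV that, of E J h] \<beta>
    by (auto simp: a_def S_def abs_mult intro!: mult_left_mono)
  have w: "sca_weight V E J h \<beta> q \<rho> = exp (card V * q) * (exp (- \<beta> * ?H \<rho>) * Z \<rho>)"
    if "\<rho> \<in> configs V" for \<rho>
    unfolding sca_weight_eq[OF graph that] Z_def a_def diff_conv_add_uminus exp_add ..
  have Zpos: "Z \<rho> > 0" for \<rho>
    by (simp add: Z_def prod_pos add_pos_pos)
  have "Z \<sigma> \<le> (\<Prod>x\<in>V. exp d * (1 + exp (- 2 * q) * exp (- a \<tau> x)))"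
    unfolding Z_def d_def
    by (intro prod_mono conjI one_plus_exp_ratio_bound a_le \<sigma> \<tau>) (auto intro: add_nonneg_nonneg)
  also have "\<dots> = exp (card V * d) * Z \<tau>"
    by (simp add: prod.distrib Z_def exp_of_nat_mult)
  finally have Z: "Z \<sigma> \<le> exp (card V * d) * Z \<tau>" .
  have "exp (- \<beta> * ?H \<tau>) * Z \<tau> \<le> exp (- \<beta> * ?H \<sigma>) * Z \<sigma>"
    using le by (simp add: w \<sigma> \<tau>)
  also have "\<dots> \<le> exp (- \<beta> * ?H \<sigma>) * (exp (card V * d) * Z \<tau>)"
    using Z by (intro mult_left_mono) auto
  finally have "exp (- \<beta> * ?H \<tau>) * Z \<tau> \<le> exp (- \<beta> * ?H \<sigma> + card V * d) * Z \<tau>"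
    by (simp only: exp_add mult.assoc)
  then have "- \<beta> * ?H \<tau> \<le> - \<beta> * ?H \<sigma> + card V * d"
    using Zpos[of \<tau>] by (simp only: mult_le_cancel_right_pos exp_le_cancel_iff)
  then have "\<beta> * ?H \<sigma> \<le> \<beta> * (?H \<tau> +
      card V * exp (- 2 * q) * (2 * max_cavity_field V E J h * exp S))"
    by (simp add: d_def S_def algebra_simps)
  then show ?thesis using \<beta> by (simp add: S_def)
qed

section \<open>The energy range dominates the standard deviation of the energy\<close>

text \<open>
  Orthogonality of the Walsh functions: if \<open>x\<close> lies in exactly one of the two sets, the summand changes
  sign under the flip at \<open>x\<close>, which permutes the configurations.
\<close>

lemma sum_configs_prod_mult_prod:
  assumes "finite V" "A \<subseteq> V" "B \<subseteq> V"
  shows "(\<Sum>\<sigma>\<in>configs V. prod \<sigma> A * prod \<sigma> B) = (if A = B then real (card (configs V)) else 0)"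
proof (cases "A = B")
  case True
  have "prod \<sigma> B * prod \<sigma> B = 1" if "\<sigma> \<in> configs V" for \<sigma>
    unfolding prod.distrib[symmetric]
    by (rule prod.neutral) (use assms(3) spin_mult_self[OF that] in auto)
  then show ?thesis using True by simp
next
  case False
  have flip_in: "prod (flip \<sigma> x) C = - prod \<sigma> C" if "x \<in> C" "C \<subseteq> V" for \<sigma> :: "'a \<Rightarrow> real" and x C
  proof -
    have "finite C" using that assms finite_subset by blast
    moreover have "prod (flip \<sigma> x) (C - {x}) = prod \<sigma> (C - {x})"
      by (rule prod.cong) (auto simp: flip_apply)
    ultimately show ?thesis
      using that by (simp add: prod.remove[of C x] flip_apply)
  qed
  have flip_out: "prod (flip \<sigma> x) C = prod \<sigma> C" if "x \<notin> C" for \<sigma> :: "'a \<Rightarrow> real" and x C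
    by (rule prod.cong) (use that in \<open>auto simp: flip_apply\<close>)
  obtain x where x: "x \<in> V" "x \<in> A \<longleftrightarrow> x \<notin> B" using False assms by blast
  have "(\<Sum>\<sigma>\<in>configs V. prod \<sigma> A * prod \<sigma> B) =
      (\<Sum>\<sigma>\<in>configs V. prod (flip \<sigma> x) A * prod (flip \<sigma> x) B)"
    by (rule sum_configs_flip[OF x(1), symmetric])
  also have "\<dots> = - (\<Sum>\<sigma>\<in>configs V. prod \<sigma> A * prod \<sigma> B)"
    unfolding sum_negf[symmetric]
    by (rule sum.cong[OF refl], cases "x \<in> A") (use x assms in \<open>auto simp: flip_in flip_out\<close>)
  finally show ?thesis using False by simp
qed

lemma walsh_parseval:
  fixes c :: "'a set \<Rightarrow> real"
  assumes "finite V" "F \<subseteq> Pow V"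
  shows "(\<Sum>\<sigma>\<in>configs V. (\<Sum>A\<in>F. c A * prod \<sigma> A)\<^sup>2) = card (configs V) * (\<Sum>A\<in>F. (c A)\<^sup>2)"
proof -
  have finF: "finite F" using assms finite_subset by blast
  have "(\<Sum>\<sigma>\<in>configs V. (\<Sum>A\<in>F. c A * prod \<sigma> A)\<^sup>2) =
      (\<Sum>\<sigma>\<in>configs V. \<Sum>A\<in>F. \<Sum>B\<in>F. c A * c B * (prod \<sigma> A * prod \<sigma> B))"
    by (simp add: power2_eq_square sum_product mult_ac)
  also have "\<dots> = (\<Sum>A\<in>F. \<Sum>\<sigma>\<in>configs V. \<Sum>B\<in>F. c A * c B * (prod \<sigma> A * prod \<sigma> B))"
    by (rule sum.swap)
  also have "\<dots> = (\<Sum>A\<in>F. \<Sum>B\<in>F. c A * c B * (\<Sum>\<sigma>\<in>configs V. prod \<sigma> A * prod \<sigma> B))"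
    unfolding sum_distrib_left by (intro sum.cong refl sum.swap)
  also have "\<dots> = (\<Sum>A\<in>F. \<Sum>B\<in>F. if A = B then c A * c B * card (configs V) else 0)"
    by (intro sum.cong refl, subst sum_configs_prod_mult_prod) (use assms in auto)
  also have "\<dots> = card (configs V) * (\<Sum>A\<in>F. (c A)\<^sup>2)"
    using finF by (simp add: sum_distrib_left power2_eq_square mult_ac)
  finally show ?thesis .
qed

text \<open>
  Edges have two elements and local fields sit on singletons, so the energy is a Walsh sum over distinct
  nonempty vertex sets, with \<open>v\<close> as the sum of the squared coefficients.
\<close>

lemma hamiltonian_walsh_expansion:
  assumes "simple_graph V E"
  obtains F :: "'a set set" and c :: "'a set \<Rightarrow> real"
  where "F \<subseteq> Pow V" "{} \<notin> F"
    and "\<And>\<sigma>. hamiltonian V E J h \<sigma> = (\<Sum>A\<in>F. c A * prod \<sigma> A)"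
    and "square_sum V E J h = (\<Sum>A\<in>F. (c A)\<^sup>2)"
proof -
  let ?S = "(\<lambda>x. {x}) ` V"
  define c where "c A = (if A \<in> E then - J A else - h (the_elem A))" for A
  have finV: "finite V" and sub: "E \<subseteq> Pow V" and card: "\<And>e. e \<in> E \<Longrightarrow> card e = 2"
    using assms by (auto simp: simple_graph_def)
  have finE: "finite E" using sub finV finite_subset by blast
  have sing: "{x} \<notin> E" for x using card[of "{x}"] by auto
  have split: "(\<Sum>A\<in>E \<union> ?S. g A) = (\<Sum>e\<in>E. g e) + (\<Sum>x\<in>V. g {x})" for g :: "'a set \<Rightarrow> real"
    using finV finE sing by (subst sum.union_disjoint) (auto simp: sum.reindex)
  show thesis
  proof
    show "E \<union> ?S \<subseteq> Pow V" using sub by auto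
    show "{} \<notin> E \<union> ?S" using card[of "{}"] by auto
    show "hamiltonian V E J h \<sigma> = (\<Sum>A\<in>E \<union> ?S. c A * prod \<sigma> A)" for \<sigma>
      unfolding split by (simp add: hamiltonian_def c_def sing sum_negf)
    show "square_sum V E J h = (\<Sum>A\<in>E \<union> ?S. (c A)\<^sup>2)"
      unfolding split by (simp add: square_sum_def c_def sing)
  qed
qed

lemma energy_difference_le_range:
  assumes "finite V" "\<sigma> \<in> configs V" "\<tau> \<in> configs V"
  shows "\<bar>hamiltonian V E J h \<sigma> - hamiltonian V E J h \<tau>\<bar> \<le> energy_range V E J h"
proof -
  let ?H = "hamiltonian V E J h"
  have eq: "{\<bar>?H \<sigma> - ?H \<tau>\<bar> | \<sigma> \<tau>. \<sigma> \<in> configs V \<and> \<tau> \<in> configs V}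
      = (\<lambda>(\<sigma>, \<tau>). \<bar>?H \<sigma> - ?H \<tau>\<bar>) ` (configs V \<times> configs V)" by auto
  show ?thesis
    unfolding energy_range_def eq
    by (rule Max_ge) (use assms finite_configs[OF assms(1)] in \<open>auto simp: image_iff\<close>)
qed

lemma energy_range_nonneg:
  assumes "finite V"
  shows "0 \<le> energy_range V E J h"
proof -
  obtain \<sigma> where "\<sigma> \<in> configs V" using configs_nonempty by blast
  then show ?thesis using energy_difference_le_range[OF assms, of \<sigma> \<sigma> E J h] by simp
qed

text \<open>
  The energy has mean zero, so each value is an average of energy differences and is bounded by the
  range. The mean of the squares is \<open>v\<close>, which is therefore at most the square of the range.
\<close>

lemma sqrt_square_sum_le_energy_range:
  assumes "simple_graph V E"
  shows "sqrt (square_sum V E J h) \<le> energy_range V E J h"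
proof -
  let ?H = "hamiltonian V E J h" and ?R = "energy_range V E J h" and ?n = "real (card (configs V))"
  have finV: "finite V" using assms by (simp add: simple_graph_def)
  have npos: "?n > 0"
    using finite_configs[OF finV] configs_nonempty[of V] by (simp add: card_gt_0_iff)
  obtain F and c :: "'a set \<Rightarrow> real" where F: "F \<subseteq> Pow V" "{} \<notin> F"
    and H: "\<And>\<sigma>. ?H \<sigma> = (\<Sum>A\<in>F. c A * prod \<sigma> A)"
    and v: "square_sum V E J h = (\<Sum>A\<in>F. (c A)\<^sup>2)"
    using hamiltonian_walsh_expansion[OF assms] by blast
  \<comment> \<open>A nonempty vertex set is orthogonal to the empty one, whose product of spins is 1.\<close>
  have "(\<Sum>\<sigma>\<in>configs V. ?H \<sigma>) = (\<Sum>A\<in>F. c A * (\<Sum>\<sigma>\<in>configs V. prod \<sigma> A))"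
    unfolding H by (subst sum.swap) (simp add: sum_distrib_left)
  also have "\<dots> = 0"
  proof (rule sum.neutral, rule ballI)
    fix A assume "A \<in> F"
    then have "A \<noteq> {}" "A \<subseteq> V" using F by auto
    then show "c A * (\<Sum>\<sigma>\<in>configs V. prod \<sigma> A) = 0"
      using sum_configs_prod_mult_prod[OF finV, of A "{}"] by simp
  qed
  finally have mean: "(\<Sum>\<sigma>\<in>configs V. ?H \<sigma>) = 0" .
  have bound: "\<bar>?H \<sigma>\<bar> \<le> ?R" if \<sigma>: "\<sigma> \<in> configs V" for \<sigma>
  proof -
    have "?n * ?H \<sigma> = (\<Sum>\<tau>\<in>configs V. ?H \<sigma> - ?H \<tau>)" by (simp add: sum_subtractf mean)
    then have "\<bar>?n * ?H \<sigma>\<bar> \<le> (\<Sum>\<tau>\<in>configs V. \<bar>?H \<sigma> - ?H \<tau>\<bar>)" by (simp add: sum_abs)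
    also have "\<dots> \<le> ?n * ?R"
      by (rule sum_bounded_above) (rule energy_difference_le_range[OF finV \<sigma>])
    finally show ?thesis using npos by (simp add: abs_mult)
  qed
  have "?n * square_sum V E J h = (\<Sum>\<sigma>\<in>configs V. (?H \<sigma>)\<^sup>2)"
    unfolding H v by (rule walsh_parseval[OF finV F(1), symmetric])
  also have "\<dots> \<le> ?n * ?R\<^sup>2"
    by (rule sum_bounded_above) (use bound power_mono[OF bound, of _ 2] in simp)
  finally have "square_sum V E J h \<le> ?R\<^sup>2" using npos by simp
  then show ?thesis
    using energy_range_nonneg[OF finV] by (simp add: real_le_lsqrt)
qed

section \<open>Order-preservation\<close>

lemma prob_on_configs_sca_equilibrium:
  assumes "finite V"
  shows "prob_on_configs V (sca_equilibrium V E J h \<beta> q)"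
proof -
  let ?Z = "\<Sum>\<sigma>\<in>configs V. sca_weight V E J h \<beta> q \<sigma>"
  have Z: "?Z > 0"
    by (rule sum_pos[OF finite_configs[OF assms] configs_nonempty sca_weight_pos[OF assms]])
  have "0 \<le> sca_equilibrium V E J h \<beta> q \<sigma>" for \<sigma>
    using Z sca_weight_pos[OF assms, of E J h \<beta> q \<sigma>] by (simp add: sca_equilibrium_def)
  moreover have "(\<Sum>\<sigma>\<in>configs V. sca_equilibrium V E J h \<beta> q \<sigma>) = 1"
    using Z by (simp add: sca_equilibrium_def sum_divide_distrib[symmetric])
  ultimately show ?thesis by (simp add: prob_on_configs_def)
qed

text \<open>
  The normalisation is common to all configurations, so order questions concern the weights alone.
\<close>

lemma sca_equilibrium_le_iff:
  assumes "finite V"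
  shows "sca_equilibrium V E J h \<beta> q \<tau> \<le> sca_equilibrium V E J h \<beta> q \<sigma> \<longleftrightarrow>
    sca_weight V E J h \<beta> q \<tau> \<le> sca_weight V E J h \<beta> q \<sigma>"
proof -
  have "(\<Sum>\<sigma>\<in>configs V. sca_weight V E J h \<beta> q \<sigma>) > 0"
    by (rule sum_pos[OF finite_configs[OF assms] configs_nonempty sca_weight_pos[OF assms]])
  then show ?thesis by (simp add: sca_equilibrium_def divide_le_cancel)
qed

text \<open>
  Positive \<open>\<beta>\<close> excludes the degenerate cases of the bound on \<open>\<beta>\<close>. Without vertices the logarithm is
  \<open>ln 0 = 0\<close>, and with vanishing cavity fields the factor is \<open>1 / 0 = 0\<close>, so the bound would force
  \<open>\<beta> \<le> 0\<close>. Otherwise exponentiating it gives even \<open>exp (2 \<beta> K)\<close> on the left of the second claim.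
\<close>

lemma positive_temperature_condition:
  assumes graph: "simple_graph V E" and \<beta>: "\<beta> > 0" and \<epsilon>: "\<epsilon> > 0"
    and le: "\<beta> \<le> 1 / (2 * max_cavity_field V E J h) *
      ln (\<epsilon> * sqrt (square_sum V E J h) / (2 * max_cavity_field V E J h))"
  shows "V \<noteq> {}"
    and "2 * max_cavity_field V E J h * exp (\<beta> * max_cavity_field V E J h)
      \<le> \<epsilon> * sqrt (square_sum V E J h)"
proof -
  let ?K = "max_cavity_field V E J h" and ?v = "square_sum V E J h"
  have finV: "finite V" using graph by (simp add: simple_graph_def)
  show ne: "V \<noteq> {}"
  proof
    assume "V = {}"
    then have "E = {}" using graph by (force simp: simple_graph_def)
    then have "?v = 0" using \<open>V = {}\<close> by (simp add: square_sum_def)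
    then show False using le \<beta> by simp
  qed
  obtain x \<sigma> where "x \<in> V" "\<sigma> \<in> configs V" using ne configs_nonempty by blast
  then have "0 \<le> ?K" using abs_cavity_field_le_max[OF finV, of \<sigma> x E J h] by linarith
  moreover have "?K \<noteq> 0" using le \<beta> by auto
  ultimately have K: "?K > 0" by simp
  let ?X = "\<epsilon> * sqrt ?v / (2 * ?K)"
  have L: "2 * ?K * \<beta> \<le> ln ?X" using le K by (simp add: field_simps)
  have "?v \<ge> 0" by (simp add: square_sum_def sum_nonneg)
  then have "?X \<ge> 0" using K \<epsilon> by simp
  moreover have "?X \<noteq> 0"
  proof
    assume "?X = 0"
    then have "ln ?X = 0" by (simp only: ln_0)
    then show False using L mult_pos_pos[OF K \<beta>] by simp
  qed
  ultimately have "?X > 0" by linarith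
  have "exp (\<beta> * ?K) \<le> exp (2 * ?K * \<beta>)" using K \<beta> by simp
  also have "\<dots> \<le> ?X" using L \<open>?X > 0\<close> by (simp add: ln_ge_iff)
  finally show "2 * ?K * exp (\<beta> * ?K) \<le> \<epsilon> * sqrt ?v" using K by (simp add: field_simps)
qed

theorem theorem5p1:
  fixes V :: "'a set" and E :: "'a set set"
    and J :: "'a set \<Rightarrow> real" and h :: "'a \<Rightarrow> real"
    and \<beta> \<epsilon> :: real
  assumes graph: "simple_graph V E"
    and beta_nonneg: "0 \<le> \<beta>"
    and eps_pos: "0 < \<epsilon>"
    and beta_le: "\<beta> \<le> 1 / (2 * max_cavity_field V E J h) *
           ln (\<epsilon> * sqrt (square_sum V E J h) / (2 * max_cavity_field V E J h))"
    and beta_zero: "\<beta> = 0 \<Longrightarrow> 1 \<le> \<epsilon>"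
    and one_vertex: "card V = 1 \<Longrightarrow> \<beta> = 0"
  shows "\<exists>q::real. 0 \<le> q \<and>
    (\<forall>\<sigma>\<in>configs V.
       expected_spin_flips V (glauber_kernel V E J h \<beta>) \<sigma>
         \<le> expected_spin_flips V (sca_kernel V E J h \<beta> q) \<sigma>) \<and>
    order_close V E J h \<epsilon> (sca_equilibrium V E J h \<beta> q) \<and>
    (\<forall>\<sigma>\<in>configs V.
       (\<forall>\<tau>\<in>configs V. sca_equilibrium V E J h \<beta> q \<tau> \<le> sca_equilibrium V E J h \<beta> q \<sigma>) \<longrightarrow>
       (\<forall>\<tau>\<in>configs V.
          hamiltonian V E J h \<sigma> \<le> hamiltonian V E J h \<tau> + \<epsilon> * energy_range V E J h))"
proof -
  have finV: "finite V" using graph by (simp add: simple_graph_def)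
  let ?H = "hamiltonian V E J h" and ?R = "energy_range V E J h"
  have "\<exists>q\<ge>0.
      (\<forall>\<sigma>\<in>configs V. expected_spin_flips V (glauber_kernel V E J h \<beta>) \<sigma>
         \<le> expected_spin_flips V (sca_kernel V E J h \<beta> q) \<sigma>) \<and>
      (\<forall>\<sigma>\<in>configs V. \<forall>\<tau>\<in>configs V. sca_weight V E J h \<beta> q \<tau> \<le> sca_weight V E J h \<beta> q \<sigma> \<longrightarrow>
         ?H \<sigma> \<le> ?H \<tau> + \<epsilon> * ?R)"
  proof (cases "\<beta> = 0")
    case True
    have "?H \<sigma> \<le> ?H \<tau> + \<epsilon> * ?R" if "\<sigma> \<in> configs V" "\<tau> \<in> configs V" for \<sigma> \<tau>
      using energy_difference_le_range[OF finV that, of E J h]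
        mult_right_mono[OF beta_zero[OF True] energy_range_nonneg[OF finV, of E J h]] by linarith
    moreover have "expected_spin_flips V (glauber_kernel V E J h \<beta>) \<sigma>
        \<le> expected_spin_flips V (sca_kernel V E J h \<beta> 0) \<sigma>" if "\<sigma> \<in> configs V" for \<sigma>
      unfolding expected_spin_flips_glauber[OF graph that] expected_spin_flips_sca[OF finV that]
      by (rule sum_mono) (use True in \<open>simp add: divide_simps\<close>)
    ultimately show ?thesis by (intro exI[of _ 0]) auto
  next
    case False
    then have \<beta>: "\<beta> > 0" using beta_nonneg by simp
    have "card V \<noteq> 0" "card V \<noteq> 1"
      using positive_temperature_condition(1)[OF graph \<beta> eps_pos beta_le] finV one_vertex False by auto
    then have card: "card V \<ge> 2" by linarith
    define q where "q = ln (real (card V)) / 2"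
    have q: "q \<ge> 0" and nq: "real (card V) * exp (- 2 * q) = 1"
      using card by (simp_all add: q_def exp_minus)
    have "?H \<sigma> \<le> ?H \<tau> + \<epsilon> * ?R"
      if "\<sigma> \<in> configs V" "\<tau> \<in> configs V"
        "sca_weight V E J h \<beta> q \<tau> \<le> sca_weight V E J h \<beta> q \<sigma>" for \<sigma> \<tau>
    proof -
      have "?H \<sigma> \<le> ?H \<tau> + 2 * max_cavity_field V E J h * exp (\<beta> * max_cavity_field V E J h)"
        using sca_order_energy_bound[OF graph that(1,2) \<beta> that(3)] unfolding nq by simp
      also have "\<dots> \<le> ?H \<tau> + \<epsilon> * sqrt (square_sum V E J h)"
        using positive_temperature_condition(2)[OF graph \<beta> eps_pos beta_le] by simp
      also have "\<dots> \<le> ?H \<tau> + \<epsilon> * ?R"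
        using sqrt_square_sum_le_energy_range[OF graph] eps_pos by simp
      finally show ?thesis .
    qed
    then show ?thesis
      using q sca_flips_at_least_glauber[OF graph _ card, of _ J h \<beta>] unfolding q_def by blast
  qed
  then obtain q where q: "q \<ge> 0"
    and flips: "\<forall>\<sigma>\<in>configs V. expected_spin_flips V (glauber_kernel V E J h \<beta>) \<sigma>
         \<le> expected_spin_flips V (sca_kernel V E J h \<beta> q) \<sigma>"
    and order: "\<And>\<sigma> \<tau>. \<sigma> \<in> configs V \<Longrightarrow> \<tau> \<in> configs V \<Longrightarrow>
      sca_equilibrium V E J h \<beta> q \<tau> \<le> sca_equilibrium V E J h \<beta> q \<sigma> \<Longrightarrow>
      ?H \<sigma> \<le> ?H \<tau> + \<epsilon> * ?R"
    unfolding sca_equilibrium_le_iff[OF finV] by blast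
  then show ?thesis
    using prob_on_configs_sca_equilibrium[OF finV] by (auto simp: order_close_def)
qed

end
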